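(* Fix positive integers $F_m^S,F_n^P$ and the per-subcarrier model described in the context. For each integer $F\ge\max\{F_m^S,F_n^P\}$ let $A_F=\mathbb{E}[C_m^1]$ be the average capacity of the $m$th secondary user in the presence of a single ($n$th) primary user when $F$ subcarriers are available. Then, as $F\to\infty$, the sequence $(A_F)$ converges logarithmically to $F_m^S\,\mathbb{E}\left[C_{m,i}^{NI}\right]$.
   Context: Logarithmic convergence: a sequence $(A_n)$ converging to $A$ is logarithmically convergent if both limits $\lim_{n\to\infty}|\Delta A_{n+1}|/|\Delta A_n|$ and $\lim_{n\to\infty}|A_{n+1}-A|/|A_n-A|$ exist and equal $1$, where $\Delta A_n=A_{n+1}-A_n$. Model. There are $F$ subcarriers, of which a fixed set of $F_n^P$ are used by the primary user (PU). The secondary user (SU) picks a set of $F_m^S$ of the $F$ subcarriers uniformly at random (without replacement). Let $k_{nm}$ be the number of picked subcarriers that are used by the PU (collisions) and $k_{fm}=F_m^S-k_{nm}$ the number of collision-free ones; $k_{nm}$ is hypergeometric. Per-subcarrier quantities (not depending on $F$): $P_{m,i},P_{n,i},\Psi_i,\eta>0$ are constants not depending on the subcarrier index $i$ (SU peak transmit power, PU transmit power, interference temperature, noise variance). $h_{m,i},h_{mp,i},g_{ns,i}$ are independent strictly positive random variables (channel power gains, arbitrary fading distributions), i.i.d. over $i$. Set $\lambda_{m,i}=h_{m,i}\min\{P_{m,i},\Psi_i/h_{mp,i}\}$, $C_{m,i}^{I,n}=\log\bigl(1+\lambda_{m,i}/(P_{n,i}g_{ns,i}+\eta)\bigr)$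 and $C_{m,i}^{NI}=\log(1+\lambda_{m,i}/\eta)$ (natural logarithm), assumed to have finite mean. The variables $C_{m,i}^{I,n}$ are identically distributed in $i$, and so are $C_{m,i}^{NI}$; the random subcarrier choice is independent of the channel gains. The SU capacity with collisions is $$C_m^1=\sum_{i=1}^{k_{nm}}C_{m,i}^{I,n}+\sum_{i=1}^{k_{fm}}C_{m,i}^{NI}.$$ *)

theory Defs
  imports "HOL-Probability.Probability"
begin

text \<open>Since division by zero yields zero, either ratio tending to 1 already forces
  its denominator to be eventually nonzero.\<close>

definition logarithmically_convergent_to :: "(nat \<Rightarrow> real) \<Rightarrow> real \<Rightarrow> bool" where
  "logarithmically_convergent_to A L \<longleftrightarrow>
     A \<longlonglongrightarrow> L \<and>
     (\<lambda>n. \<bar>A (Suc (Suc n)) - A (Suc n)\<bar> / \<bar>A (Suc n) - A n\<bar>) \<longlonglongrightarrow> 1 \<and>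
     (\<lambda>n. \<bar>A (Suc n) - L\<bar> / \<bar>A n - L\<bar>) \<longlonglongrightarrow> 1"

text \<open>The three kinds of channel power gain on a subcarrier \<open>i\<close>:
  \<open>SU_link\<close> is \<open>h\<^sub>m\<close> (secondary transmitter to its own receiver),
  \<open>SU_to_PU\<close> is \<open>h\<^sub>m\<^sub>p\<close> (secondary transmitter to the primary receiver),
  \<open>PU_to_SU\<close> is \<open>g\<^sub>n\<^sub>s\<close> (primary transmitter to the secondary receiver).
  The gains form a family \<open>G :: link \<Rightarrow> nat \<Rightarrow> 'a \<Rightarrow> real\<close>, and
  subcarriers are numbered from 0.\<close>

datatype link = SU_link | SU_to_PU | PU_to_SU

text \<open>\<open>Pm\<close>: peak transmit power of the secondary user; \<open>Psi\<close>: interference temperature;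
  \<open>Pn\<close>: transmit power of the primary user; \<open>eta\<close>: noise variance.\<close>

definition rx_power :: "real \<Rightarrow> real \<Rightarrow> (link \<Rightarrow> nat \<Rightarrow> 'a \<Rightarrow> real) \<Rightarrow> nat \<Rightarrow> 'a \<Rightarrow> real" where
  "rx_power Pm Psi G i \<omega> = G SU_link i \<omega> * min Pm (Psi / G SU_to_PU i \<omega>)"

definition cap_I ::
  "real \<Rightarrow> real \<Rightarrow> real \<Rightarrow> real \<Rightarrow> (link \<Rightarrow> nat \<Rightarrow> 'a \<Rightarrow> real) \<Rightarrow> nat \<Rightarrow> 'a \<Rightarrow> real" where
  "cap_I Pm Psi Pn eta G i \<omega> =
     ln (1 + rx_power Pm Psi G i \<omega> / (Pn * G PU_to_SU i \<omega> + eta))"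

definition cap_NI ::
  "real \<Rightarrow> real \<Rightarrow> real \<Rightarrow> (link \<Rightarrow> nat \<Rightarrow> 'a \<Rightarrow> real) \<Rightarrow> nat \<Rightarrow> 'a \<Rightarrow> real" where
  "cap_NI Pm Psi eta G i \<omega> = ln (1 + rx_power Pm Psi G i \<omega> / eta)"

text \<open>Capacity of a secondary user who has picked the set \<open>T\<close> of subcarriers while the primary
  user occupies \<open>U\<close>. The collision-affected and the collision-free terms are each
  relabelled to start at the first index.\<close>

definition su_capacity ::
  "real \<Rightarrow> real \<Rightarrow> real \<Rightarrow> real \<Rightarrow> (link \<Rightarrow> nat \<Rightarrow> 'a \<Rightarrow> real) \<Rightarrow> nat set \<Rightarrow> nat set \<Rightarrow> 'a \<Rightarrow> real" where
  "su_capacity Pm Psi Pn eta G U T \<omega> =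
     (\<Sum>i<card (T \<inter> U). cap_I Pm Psi Pn eta G i \<omega>) +
     (\<Sum>i<card T - card (T \<inter> U). cap_NI Pm Psi eta G i \<omega>)"

definition selections :: "nat \<Rightarrow> nat \<Rightarrow> nat set set" where
  "selections F k = {T. T \<subseteq> {..<F} \<and> card T = k}"

definition generated_events :: "'a measure \<Rightarrow> 'b measure \<Rightarrow> ('a \<Rightarrow> 'b) \<Rightarrow> 'a set set" where
  "generated_events M N X = sets (vimage_algebra (space M) X N)"

end

theory Submission
  imports Defs "HOL-Real_Asymp.Real_Asymp"
begin

text \<open>By independence of the selection and the gains, \<open>A\<^sub>F\<close> is the average over all selections
  \<open>T\<close> of \<open>c E[C\<^sup>I] + (F\<^sup>S - c) E[C\<^sup>N\<^sup>I]\<close> with \<open>c = card (T \<inter> U)\<close>. The average of \<open>c\<close> is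
  \<open>F\<^sup>S F\<^sup>P / F\<close>, so \<open>A\<^sub>F = F\<^sup>S E[C\<^sup>N\<^sup>I] - d / F\<close> with
  \<open>d = F\<^sup>S F\<^sup>P (E[C\<^sup>N\<^sup>I] - E[C\<^sup>I])\<close>. Interference strictly lowers the capacity almost surely,
  so \<open>d > 0\<close>, and a sequence of this form converges logarithmically.\<close>

section \<open>Logarithmic convergence of sequences \<open>L - d / n\<close>\<close>

lemma logarithmically_convergent_to_harmonic:
  assumes "d \<noteq> 0" and A: "eventually (\<lambda>n. A n = L - d / real n) sequentially"
  shows "logarithmically_convergent_to A L"
proof -
  have A1: "eventually (\<lambda>n. A (Suc n) = L - d / real (Suc n)) sequentially"
    using A by (rule eventually_compose_filterlim[OF _ filterlim_Suc])
  have A2: "eventually (\<lambda>n. A (Suc (Suc n)) = L - d / real (Suc (Suc n))) sequentially"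
    using A1 by (rule eventually_compose_filterlim[OF _ filterlim_Suc])
  have pos: "eventually (\<lambda>n. n > 0) sequentially"
    by (rule eventually_gt_at_top)
  have "(\<lambda>n. L - d / real n) \<longlonglongrightarrow> L"
    by real_asymp
  then have "A \<longlonglongrightarrow> L"
    using A by (simp add: tendsto_cong)
  \<comment> \<open>Consecutive differences are \<open>d / (n * (n + 1))\<close>, so
    \<open>d\<close> cancels and the ratio is exactly \<open>n / (n + 2)\<close> for large
    \<open>n\<close>. With \<open>d = 0\<close> every ratio would be \<open>0 / 0 = 0\<close>, hence
    the assumption on \<open>d\<close>.\<close>
  moreover have "(\<lambda>n. \<bar>A (Suc (Suc n)) - A (Suc n)\<bar> / \<bar>A (Suc n) - A n\<bar>) \<longlonglongrightarrow> 1"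
  proof (rule Lim_transform_eventually)
    show "(\<lambda>n. real n / (real n + 2)) \<longlonglongrightarrow> 1"
      by real_asymp
    show "eventually (\<lambda>n. real n / (real n + 2)
        = \<bar>A (Suc (Suc n)) - A (Suc n)\<bar> / \<bar>A (Suc n) - A n\<bar>) sequentially"
      using A A1 A2 pos
    proof eventually_elim
      case (elim n)
      have "A (Suc n) - A n = d / (real n * (real n + 1))"
        using elim(4) unfolding elim(1,2) by (simp add: field_simps)
      moreover have "A (Suc (Suc n)) - A (Suc n) = d / ((real n + 1) * (real n + 2))"
        unfolding elim(2,3) by (simp add: field_simps)
      ultimately show ?case
        using elim(4) \<open>d \<noteq> 0\<close> by (simp add: abs_mult)
    qed
  qed
  moreover have "(\<lambda>n. \<bar>A (Suc n) - L\<bar> / \<bar>A n - L\<bar>) \<longlonglongrightarrow> 1"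
  proof (rule Lim_transform_eventually)
    show "(\<lambda>n. real n / (real n + 1)) \<longlonglongrightarrow> 1"
      by real_asymp
    show "eventually (\<lambda>n. real n / (real n + 1) = \<bar>A (Suc n) - L\<bar> / \<bar>A n - L\<bar>) sequentially"
      using A A1 pos
    proof eventually_elim
      case (elim n)
      then show ?case
        using \<open>d \<noteq> 0\<close> by simp
    qed
  qed
  ultimately show ?thesis
    by (simp add: logarithmically_convergent_to_def)
qed

section \<open>Counting selections: the mean number of collisions\<close>

lemma finite_selections: "finite (selections F k)"
  by (rule finite_subset[of _ "Pow {..<F}"]) (auto simp: selections_def)

lemma card_selections: "card (selections F k) = F choose k"
  unfolding selections_def using n_subsets[of "{..<F}" k] by simp

text \<open>Deleting \<open>u\<close> is a bijection onto the \<open>k - 1\<close>-subsets of the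
  other \<open>F - 1\<close> indices. For \<open>k = 0\<close> the truncated \<open>k - 1\<close>
  would give 1 instead of 0.\<close>

lemma card_selections_containing:
  assumes "u < F" and "k > 0"
  shows "card {T \<in> selections F k. u \<in> T} = (F - 1) choose (k - 1)"
proof -
  have "bij_betw (insert u) {T. T \<subseteq> {..<F} - {u} \<and> card T = k - 1} {T \<in> selections F k. u \<in> T}"
  proof (rule bij_betw_byWitness[where f' = "\<lambda>T. T - {u}"])
    show "insert u ` {T. T \<subseteq> {..<F} - {u} \<and> card T = k - 1} \<subseteq> {T \<in> selections F k. u \<in> T}"
    proof clarsimp
      fix T assume T: "T \<subseteq> {..<F} - {u}" "card T = k - Suc 0"
      then have "finite T" "u \<notin> T"
        by (auto intro: finite_subset)
      then show "insert u T \<in> selections F k"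
        using T assms by (auto simp: selections_def)
    qed
    show "(\<lambda>T. T - {u}) ` {T \<in> selections F k. u \<in> T} \<subseteq> {T. T \<subseteq> {..<F} - {u} \<and> card T = k - 1}"
      by (auto simp: selections_def)
  qed auto
  then have "card {T \<in> selections F k. u \<in> T} = card {T. T \<subseteq> {..<F} - {u} \<and> card T = k - 1}"
    by (simp add: bij_betw_same_card)
  also have "\<dots> = (F - 1) choose (k - 1)"
    using n_subsets[of "{..<F} - {u}" "k - 1"] assms by simp
  finally show ?thesis .
qed

text \<open>Double counting of the pairs of a selection \<open>T\<close> and an element
  \<open>u\<close> of \<open>T \<inter> U\<close>, followed by the absorption identity for
  \<open>F * ((F - 1) choose (k - 1))\<close>. The factor \<open>F\<close> on the left keeps the
  identity within the natural numbers.\<close>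

lemma sum_card_Int_selections:
  assumes "U \<in> selections F p" and "k > 0"
  shows "F * (\<Sum>T\<in>selections F k. card (T \<inter> U)) = k * p * (F choose k)"
proof -
  have U: "U \<subseteq> {..<F}" "card U = p" "finite U"
    using assms(1) by (auto simp: selections_def intro: finite_subset)
  have "(\<Sum>T\<in>selections F k. card (T \<inter> U)) = (\<Sum>T\<in>selections F k. \<Sum>u\<in>U. if u \<in> T then 1 else 0)"
    using U(3) by (intro sum.cong refl) (simp add: sum.If_cases Int_def conj_commute)
  also have "\<dots> = (\<Sum>u\<in>U. \<Sum>T\<in>selections F k. if u \<in> T then 1 else 0)"
    by (rule sum.swap)
  also have "\<dots> = (\<Sum>u\<in>U. card {T \<in> selections F k. u \<in> T})"
    using finite_selections[of F k] by (intro sum.cong refl) (simp add: sum.If_cases Int_def)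
  also have "\<dots> = (\<Sum>u\<in>U. (F - 1) choose (k - 1))"
    using U(1) \<open>k > 0\<close> by (intro sum.cong refl card_selections_containing) auto
  also have "\<dots> = p * ((F - 1) choose (k - 1))"
    using U(2) by simp
  finally have "F * (\<Sum>T\<in>selections F k. card (T \<inter> U)) = p * (F * ((F - 1) choose (k - 1)))"
    by simp
  also have "F * ((F - 1) choose (k - 1)) = k * (F choose k)"
    using times_binomial_minus1_eq[OF \<open>k > 0\<close>, of F] by simp
  finally show ?thesis
    by simp
qed

text \<open>This is the mean of the hypergeometric distribution; \<open>k \<le> F\<close> makes the
  binomial coefficient that is divided out nonzero.\<close>

lemma average_card_Int_selections:
  assumes "U \<in> selections F p" and "0 < k" and "k \<le> F"
  shows "(\<Sum>T\<in>selections F k. real (card (T \<inter> U))) / real (card (selections F k)) = real k * real p / real F"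
proof -
  have "real F * (\<Sum>T\<in>selections F k. real (card (T \<inter> U))) = real k * real p * real (F choose k)"
    using sum_card_Int_selections[OF assms(1,2)]
    by (metis of_nat_mult of_nat_sum)
  then show ?thesis
    using assms by (simp add: card_selections field_simps)
qed

section \<open>Independence, random choice and identical distribution\<close>

context prob_space
begin

text \<open>Functions of \<open>X\<close> and of \<open>Y\<close> generate smaller sigma-algebras
  than \<open>X\<close> and \<open>Y\<close> do, and independence passes to subfamilies of
  events.\<close>

lemma indep_var_compose_generated_events:
  assumes X: "X \<in> measurable M N1" and Y: "Y \<in> measurable M N2"
    and indep: "indep_set (generated_events M N1 X) (generated_events M N2 Y)"
    and f: "f \<in> measurable N1 L1" and g: "g \<in> measurable N2 L2"
  shows "indep_var L1 (\<lambda>\<omega>. f (X \<omega>)) L2 (\<lambda>\<omega>. g (Y \<omega>))"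
proof -
  \<comment> \<open>\<open>Z\<close> is measurable for the sigma-algebra that it generates itself,
    hence so is its composition with \<open>h\<close>.\<close>
  have sub: "sigma_sets (space M) {(\<lambda>\<omega>. h (Z \<omega>)) -` A \<inter> space M | A. A \<in> sets L} \<subseteq> generated_events M N Z"
    if "Z \<in> measurable M N" and "h \<in> measurable N L" for N :: "'n measure" and L :: "'l measure" and Z h
  proof -
    have "Z \<in> space M \<rightarrow> space N"
      using measurable_space[OF that(1)] by auto
    from measurable_compose[OF measurable_vimage_algebra1[OF this] that(2)]
    show ?thesis
      unfolding generated_events_def sets_vimage_algebra[symmetric] by (intro sets_image_in_sets) auto
  qed
  have "indep_set
      (sigma_sets (space M) {(\<lambda>\<omega>. f (X \<omega>)) -` A \<inter> space M | A. A \<in> sets L1})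
      (sigma_sets (space M) {(\<lambda>\<omega>. g (Y \<omega>)) -` A \<inter> space M | A. A \<in> sets L2})"
    using indep sub[OF X f] sub[OF Y g] unfolding indep_sets2_eq by blast
  then show ?thesis
    unfolding indep_var_eq using measurable_compose[OF X f] measurable_compose[OF Y g] by simp
qed

text \<open>Split according to the value of \<open>S\<close>: independence factors the expectation
  of each term into the probability of \<open>S = T\<close>, which is \<open>1 / card K\<close>, and
  the mean of \<open>X T\<close>. Since every \<open>X T\<close> is a function of the same
  \<open>Y\<close>, independence of \<open>S\<close> from \<open>Y\<close> is enough.\<close>

lemma integral_random_choice:
  fixes X :: "'b \<Rightarrow> 'a \<Rightarrow> real"
  assumes fin: "finite K"
    and S: "S \<in> measurable M (count_space K)"
    and unif: "distr M (count_space K) S = uniform_count_measure K"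
    and Y: "Y \<in> measurable M N"
    and indep: "indep_set (generated_events M (count_space K) S) (generated_events M N Y)"
    and X: "\<And>T. T \<in> K \<Longrightarrow> \<exists>f\<in>borel_measurable N. X T = (\<lambda>\<omega>. f (Y \<omega>))"
    and int: "\<And>T. T \<in> K \<Longrightarrow> integrable M (X T)"
  shows "(\<integral>\<omega>. X (S \<omega>) \<omega> \<partial>M) = (\<Sum>T\<in>K. (\<integral>\<omega>. X T \<omega> \<partial>M)) / card K"
proof -
  have T: "integrable M (\<lambda>\<omega>. indicator {T} (S \<omega>) * X T \<omega>)"
    "(\<integral>\<omega>. indicator {T} (S \<omega>) * X T \<omega> \<partial>M) = (\<integral>\<omega>. X T \<omega> \<partial>M) / card K" if TK: "T \<in> K" for T
  proof -
    obtain f where f: "f \<in> borel_measurable N" "X T = (\<lambda>\<omega>. f (Y \<omega>))"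
      using X[OF TK] by blast
    have iv: "indep_var borel (\<lambda>\<omega>. indicator {T} (S \<omega>) :: real) borel (X T)"
      unfolding f(2) by (rule indep_var_compose_generated_events[OF S Y indep _ f(1)]) simp
    have int1: "integrable M (\<lambda>\<omega>. indicator {T} (S \<omega>) :: real)"
      by (rule integrable_const_bound[where B = 1])
        (auto intro!: measurable_compose[OF S] simp: indicator_def)
    show "integrable M (\<lambda>\<omega>. indicator {T} (S \<omega>) * X T \<omega>)"
      by (rule indep_var_integrable[OF iv int1 int[OF TK]])
    have "(\<integral>\<omega>. (indicator {T} (S \<omega>) :: real) \<partial>M) = (\<integral>t. indicator {T} t \<partial>distr M (count_space K) S)"
      by (rule integral_distr[OF S, symmetric]) simp
    also have "\<dots> = measure (uniform_count_measure K) {T}"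
      using TK by (simp add: unif space_uniform_count_measure Int_absorb2)
    also have "\<dots> = 1 / card K"
      using TK fin by (subst measure_uniform_count_measure) auto
    finally show "(\<integral>\<omega>. indicator {T} (S \<omega>) * X T \<omega> \<partial>M) = (\<integral>\<omega>. X T \<omega> \<partial>M) / card K"
      using indep_var_lebesgue_integral[OF iv int1 int[OF TK]] by simp
  qed
  have "(\<integral>\<omega>. X (S \<omega>) \<omega> \<partial>M) = (\<integral>\<omega>. (\<Sum>T\<in>K. indicator {T} (S \<omega>) * X T \<omega>) \<partial>M)"
  proof (rule Bochner_Integration.integral_cong[OF refl])
    fix \<omega> assume "\<omega> \<in> space M"
    then have "S \<omega> \<in> K"
      using measurable_space[OF S] by simp
    then show "X (S \<omega>) \<omega> = (\<Sum>T\<in>K. indicator {T} (S \<omega>) * X T \<omega>)"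
      using fin by (simp add: indicator_def if_distrib[of "\<lambda>x. x * _"] cong: if_cong)
  qed
  also have "\<dots> = (\<Sum>T\<in>K. (\<integral>\<omega>. X T \<omega> \<partial>M) / card K)"
    using T by simp
  finally show ?thesis
    by (simp add: sum_divide_distrib)
qed

text \<open>Equal marginals alone would not suffice, because \<open>f\<close> sees all gains of one
  index jointly. Independence makes their joint law the product of the marginals, which is the same
  for \<open>j\<close> and \<open>k\<close>.\<close>

lemma expectation_gain_function_eq:
  fixes G :: "'l \<Rightarrow> 'j \<Rightarrow> 'a \<Rightarrow> real" and f :: "('l \<Rightarrow> real) \<Rightarrow> real"
  assumes indep: "indep_vars (\<lambda>_. borel) (\<lambda>(l, j). G l j) UNIV"
    and ident: "\<And>l. distr M borel (G l j) = distr M borel (G l k)"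
    and f: "f \<in> borel_measurable (PiM UNIV (\<lambda>_. borel))"
  shows "(\<integral>\<omega>. f (\<lambda>l. G l j \<omega>) \<partial>M) = (\<integral>\<omega>. f (\<lambda>l. G l k \<omega>) \<partial>M)"
proof -
  have rv: "random_variable borel (G l j)" for l j
    using indep unfolding indep_vars_def by auto
  have meas: "(\<lambda>\<omega> l. G l j \<omega>) \<in> measurable M (PiM UNIV (\<lambda>_. borel))" for j
    using rv by (intro measurable_PiM_single') auto
  have all: "(\<lambda>\<omega> (l, j). G l j \<omega>) \<in> measurable M (PiM UNIV (\<lambda>_. borel))"
    using rv by (intro measurable_PiM_single') auto
  let ?D = "\<lambda>(l, j). distr M borel (G l j)"
  have D: "distr M (PiM UNIV (\<lambda>_. borel)) (\<lambda>\<omega> (l, j). G l j \<omega>) = PiM UNIV ?D"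
    using indep_vars_iff_distr_eq_PiM[of UNIV "\<lambda>(l, j). G l j" "\<lambda>_. borel"] indep rv
    by (auto simp: case_prod_unfold restrict_def)
  \<comment> \<open>The gains of index \<open>j\<close> are a projection of the whole family, whose
    law is a product measure; reindexing along the injection \<open>l \<mapsto> (l, j)\<close> gives
    the product over that column.\<close>
  have joint: "distr M (PiM UNIV (\<lambda>_. borel)) (\<lambda>\<omega> l. G l j \<omega>) = PiM UNIV (\<lambda>l. distr M borel (G l j))" for j
  proof -
    have "distr (PiM UNIV ?D) (PiM UNIV (\<lambda>_. borel)) (\<lambda>x l. x (l, j))
        = distr (PiM UNIV ?D) (PiM UNIV (\<lambda>l. ?D (l, j))) (\<lambda>x. \<lambda>l\<in>UNIV. x (l, j))"
      by (rule distr_cong) (auto intro!: sets_PiM_cong)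
    also have "\<dots> = PiM UNIV (\<lambda>l. ?D (l, j))"
      by (rule distr_PiM_reindex) (auto simp: inj_on_def intro: prob_space_distr rv)
    finally have "distr (PiM UNIV ?D) (PiM UNIV (\<lambda>_. borel)) (\<lambda>x l. x (l, j))
        = PiM UNIV (\<lambda>l. distr M borel (G l j))"
      by simp
    then show ?thesis
      unfolding D[symmetric]
      by (subst (asm) distr_distr) (auto simp: comp_def intro!: all measurable_PiM_single')
  qed
  have "(\<integral>\<omega>. f (\<lambda>l. G l j \<omega>) \<partial>M) = (\<integral>x. f x \<partial>PiM UNIV (\<lambda>l. distr M borel (G l j)))" for j
    using integral_distr[OF meas f] joint by simp
  then show ?thesis
    using ident by simp
qed

end

section \<open>Measurability and comparison of the two capacities\<close>

lemma measurable_cap_I [measurable]: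
  assumes [measurable]: "\<And>l. G l j \<in> borel_measurable N"
  shows "cap_I Pm Psi Pn eta G j \<in> borel_measurable N"
  unfolding cap_I_def[abs_def] rx_power_def by measurable

lemma measurable_cap_NI [measurable]:
  assumes [measurable]: "\<And>l. G l j \<in> borel_measurable N"
  shows "cap_NI Pm Psi eta G j \<in> borel_measurable N"
  unfolding cap_NI_def[abs_def] rx_power_def by measurable

text \<open>The received power is positive, so the larger denominator gives a strictly smaller
  quotient, and \<open>ln\<close> is strictly increasing on positive arguments.\<close>

lemma cap_I_less_cap_NI:
  assumes "Pm > 0" "Psi > 0" "Pn > 0" "eta > 0" and "\<And>l. G l j \<omega> > 0"
  shows "cap_I Pm Psi Pn eta G j \<omega> < cap_NI Pm Psi eta G j \<omega>"
proof -
  have r: "rx_power Pm Psi G j \<omega> > 0"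
    using assms by (simp add: rx_power_def)
  have "eta < Pn * G PU_to_SU j \<omega> + eta"
    using assms by simp
  then have "rx_power Pm Psi G j \<omega> / (Pn * G PU_to_SU j \<omega> + eta) < rx_power Pm Psi G j \<omega> / eta"
    using r \<open>eta > 0\<close> by (intro divide_strict_left_mono) auto
  moreover have "0 < rx_power Pm Psi G j \<omega> / (Pn * G PU_to_SU j \<omega> + eta)"
    using r assms by (simp add: add_pos_pos)
  ultimately show ?thesis
    by (simp add: cap_I_def cap_NI_def)
qed

section \<open>The exact average capacity and its limit\<close>

theorem corollary4:
  fixes M :: "'a measure"
    and G :: "link \<Rightarrow> nat \<Rightarrow> 'a \<Rightarrow> real"
    and S :: "nat \<Rightarrow> 'a \<Rightarrow> nat set"
    and U :: "nat \<Rightarrow> nat set"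
    and Pm Psi Pn eta :: real
    and FmS FnP :: nat
    and i :: nat
  assumes "prob_space M"
    and "FmS > 0" and "FnP > 0"
    and "Pm > 0" and "Psi > 0" and "Pn > 0" and "eta > 0"
    and gains_indep: "prob_space.indep_vars M (\<lambda>_. borel) (\<lambda>(l, j). G l j) (UNIV :: (link \<times> nat) set)"
    and gains_ident: "\<And>l j k. distr M borel (G l j) = distr M borel (G l k)"
    and gains_pos: "\<And>l j. AE \<omega> in M. G l j \<omega> > 0"
    and cap_I_mean: "\<And>j. integrable M (cap_I Pm Psi Pn eta G j)"
    and cap_NI_mean: "\<And>j. integrable M (cap_NI Pm Psi eta G j)"
    and PU_set: "\<And>F. F \<ge> max FmS FnP \<Longrightarrow> U F \<in> selections F FnP"
    and SU_meas: "\<And>F. F \<ge> max FmS FnP \<Longrightarrow>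
        S F \<in> measurable M (count_space (selections F FmS))"
    and SU_uniform: "\<And>F. F \<ge> max FmS FnP \<Longrightarrow>
        distr M (count_space (selections F FmS)) (S F) = uniform_count_measure (selections F FmS)"
    and SU_indep: "\<And>F. F \<ge> max FmS FnP \<Longrightarrow>
        prob_space.indep_set M
          (generated_events M (count_space (selections F FmS)) (S F))
          (generated_events M (PiM (UNIV :: (link \<times> nat) set) (\<lambda>_. borel)) (\<lambda>\<omega> (l, j). G l j \<omega>))"
  shows "logarithmically_convergent_to
           (\<lambda>F. \<integral>\<omega>. su_capacity Pm Psi Pn eta G (U F) (S F \<omega>) \<omega> \<partial>M)
           (real FmS * (\<integral>\<omega>. cap_NI Pm Psi eta G i \<omega> \<partial>M))"
proof -
  interpret prob_space M by fact
  let ?P = "PiM (UNIV :: (link \<times> nat) set) (\<lambda>_. borel :: real measure)"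
  let ?Y = "\<lambda>\<omega> (l, j). G l j \<omega>"
  define I where "I = (\<integral>\<omega>. cap_I Pm Psi Pn eta G i \<omega> \<partial>M)"
  define N where "N = (\<integral>\<omega>. cap_NI Pm Psi eta G i \<omega> \<partial>M)"
  define d where "d = real FmS * real FnP * (N - I)"
  have rv: "random_variable borel (G l j)" for l j
    using gains_indep unfolding indep_vars_def by auto
  have Y: "?Y \<in> measurable M ?P"
    using rv by (intro measurable_PiM_single') auto
  \<comment> \<open>Feeding coordinate projections as gains turns \<open>cap_I\<close> into a
    function \<open>f\<close> of one column of gains. The index 0 is a dummy, since this family
    ignores its index.\<close>
  have I: "(\<integral>\<omega>. cap_I Pm Psi Pn eta G j \<omega> \<partial>M) = I" for j
    using expectation_gain_function_eq[OF gains_indep gains_ident,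
        of "cap_I Pm Psi Pn eta (\<lambda>l _ x. x l) 0" j i]
    by (simp add: I_def cap_I_def rx_power_def)
  have N: "(\<integral>\<omega>. cap_NI Pm Psi eta G j \<omega> \<partial>M) = N" for j
    using expectation_gain_function_eq[OF gains_indep gains_ident,
        of "cap_NI Pm Psi eta (\<lambda>l _ x. x l) 0" j i]
    by (simp add: N_def cap_NI_def rx_power_def)
  have "AE \<omega> in M. \<forall>l\<in>{SU_link, SU_to_PU, PU_to_SU}. G l i \<omega> > 0"
    using gains_pos by (intro AE_finite_allI) auto
  then have "AE \<omega> in M. cap_I Pm Psi Pn eta G i \<omega> < cap_NI Pm Psi eta G i \<omega>"
  proof eventually_elim
    case (elim \<omega>)
    have "G l i \<omega> > 0" for l
      using elim by (cases l) auto
    then show ?case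
      using assms by (intro cap_I_less_cap_NI) auto
  qed
  \<comment> \<open>An almost sure strict inequality passes to the means because the whole space has
    nonzero measure.\<close>
  then have "I < N"
    unfolding I_def N_def by (intro integral_less_AE_space cap_I_mean cap_NI_mean) (auto simp: emeasure_space_1)
  then have "d \<noteq> 0"
    using \<open>FmS > 0\<close> \<open>FnP > 0\<close> by (simp add: d_def)
  moreover have "(\<integral>\<omega>. su_capacity Pm Psi Pn eta G (U F) (S F \<omega>) \<omega> \<partial>M) = real FmS * N - d / real F"
    if F: "F \<ge> max FmS FnP" for F
  proof -
    let ?K = "selections F FmS"
    have K: "card ?K > 0"
      using F by (simp add: card_selections)
    \<comment> \<open>The means do not depend on the index, so only the number \<open>c\<close> of
      collisions matters: \<open>c * I + (FmS - c) * N\<close>. The bound \<open>c \<le> FmS\<close>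
      makes the natural subtraction exact.\<close>
    have E: "(\<integral>\<omega>. su_capacity Pm Psi Pn eta G (U F) T \<omega> \<partial>M)
        = real FmS * N - real (card (T \<inter> U F)) * (N - I)"
      and int: "integrable M (su_capacity Pm Psi Pn eta G (U F) T)" if "T \<in> ?K" for T
    proof -
      have T: "card T = FmS" "card (T \<inter> U F) \<le> FmS"
        using that by (auto simp: selections_def intro!: card_mono intro: finite_subset)
      show "integrable M (su_capacity Pm Psi Pn eta G (U F) T)"
        unfolding su_capacity_def[abs_def]
        by (intro Bochner_Integration.integrable_add Bochner_Integration.integrable_sum cap_I_mean cap_NI_mean)
      show "(\<integral>\<omega>. su_capacity Pm Psi Pn eta G (U F) T \<omega> \<partial>M)
          = real FmS * N - real (card (T \<inter> U F)) * (N - I)"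
        unfolding su_capacity_def using T
        by (simp add: cap_I_mean cap_NI_mean Bochner_Integration.integral_sum I N of_nat_diff algebra_simps)
    qed
    \<comment> \<open>The witness is the capacity itself, with the gains replaced by the coordinates
      of a point of the product space.\<close>
    have X: "\<exists>f\<in>borel_measurable ?P. su_capacity Pm Psi Pn eta G (U F) T = (\<lambda>\<omega>. f (?Y \<omega>))" for T
      by (rule bexI[of _ "su_capacity Pm Psi Pn eta (\<lambda>l j x. x (l, j)) (U F) T"])
        (auto simp: su_capacity_def[abs_def] cap_I_def cap_NI_def rx_power_def fun_eq_iff)
    have "(\<integral>\<omega>. su_capacity Pm Psi Pn eta G (U F) (S F \<omega>) \<omega> \<partial>M)
        = (\<Sum>T\<in>?K. (\<integral>\<omega>. su_capacity Pm Psi Pn eta G (U F) T \<omega> \<partial>M)) / real (card ?K)"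
      by (rule integral_random_choice[OF finite_selections SU_meas[OF F] SU_uniform[OF F] Y SU_indep[OF F] X int])
    also have "\<dots> = (\<Sum>T\<in>?K. real FmS * N - real (card (T \<inter> U F)) * (N - I)) / real (card ?K)"
      using E by simp
    also have "\<dots> = real FmS * N - (\<Sum>T\<in>?K. real (card (T \<inter> U F))) / real (card ?K) * (N - I)"
      using K by (simp add: sum_subtractf sum_distrib_right[symmetric] diff_divide_distrib)
    \<comment> \<open>The mean number of collisions is \<open>FmS * FnP / F\<close>; its product
      with \<open>N - I\<close> is \<open>d / F\<close>.\<close>
    also have "\<dots> = real FmS * N - d / real F"
      using average_card_Int_selections[OF PU_set[OF F] \<open>FmS > 0\<close>] F by (simp add: d_def)
    finally show ?thesis .
  qed
  then have "eventually (\<lambda>F. (\<integral>\<omega>. su_capacity Pm Psi Pn eta G (U F) (S F \<omega>) \<omega> \<partial>M)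
      = real FmS * N - d / real F) sequentially"
    by (auto simp only: eventually_sequentially)
  ultimately show ?thesis
    unfolding N_def[symmetric] by (rule logarithmically_convergent_to_harmonic)
qed

end
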